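(* Let $k$ be a field of characteristic $0$. For every dga $(A,\phi)$ over $k$ there are ($k$-linear) maps $$HH^n_{dg}(A)\to HH^n(A^0),\qquad HCP^0_n(A)\to HHP^0_n(A),\qquad HC^n(A^0)\to HH^n(A^0)$$ for all $n\ge 0$.
   Context: **Dgas.** A dga $(A,\phi)$ over $k$ is a unital associative graded $k$-algebra $A=\bigoplus_{m\ge 0}A^m$ with a $k$-linear map $\phi$ lowering degree by one such that $\phi^2=0$ and $\phi(xy)=\phi(x)y+(-1)^{|x|}x\phi(y)$, where $|x|$ is the degree of a homogeneous element. $A^0$ is its degree-$0$ subalgebra. $(A^{\otimes n})^m$ is the total-degree-$m$ part of $A^{\otimes n}$, and $\phi^{\otimes n}$ denotes the induced differential $\phi^{\otimes n}(a_1\otimes\dots\otimes a_n)=\sum_i(-1)^{|a_1|+\dots+|a_{i-1}|}a_1\otimes\dots\otimes\phi(a_i)\otimes\dots\otimes a_n$. For $n,m\ge 0$ put $C^n(A)^m=\mathrm{Hom}_k((A^{\otimes n+1})^m,k)$. **Operators** (on homogeneous $a_i$, with $\gamma_n=|a_n|(|a_0|+\dots+|a_{n-1}|)$): - $\delta:C^n(A)^m\to C^n(A)^{m+1}$, $\delta f=(-1)^m f\circ\phi^{\otimes n+1}$. - $b:C^{n-1}(A)^m\to C^n(A)^m$, $b(f)(a_0\otimes\dots\otimes a_n)=\sum_{i=0}^{n-1}(-1)^i f(a_0\otimes\dots\otimes a_ia_{i+1}\otimes\dots\otimes a_n)+(-1)^{n+\gamma_n}f(a_na_0\otimes a_1\otimes\dots\otimes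 a_{n-1})$. - $\tau:C^n(A)^m\to C^n(A)^m$, $\tau(f)(a_0\otimes\dots\otimes a_n)=(-1)^{n+\gamma_n}f(a_n\otimes a_0\otimes\dots\otimes a_{n-1})$; $N=\sum_{i=0}^n\tau^i$ on $C^n(A)^m$. - $s:C^{n+1}(A)^m\to C^n(A)^m$, $s(f)(a_0\otimes\dots\otimes a_n)=(-1)^n f(a_0\otimes\dots\otimes a_n\otimes 1)$. - $B=Ns(\mathbf 1-\tau):C^{n+1}(A)^m\to C^n(A)^m$ (and $B=0$ on $C^0(A)^m$). **Cohomologies.** - $HH^n_{dg}(A)$ is the $n$-th cohomology of $\bigoplus_{p+q=n}C^p(A)^q$ with differential $b+(-1)^p\delta$ on $C^p(A)^q$. - $HHP^m_n(A)$ is the $m$-th cohomology of $C^0(A)^n\xrightarrow{b}C^1(A)^n\xrightarrow{b}\cdots$. - $HCP^m_n(A)$ is the $m$-th cohomology of the complex $\bigoplus_{p+q=m,\,0\le p\le q}C^{q-p}(A)^n$ with differential $b+B$. - $HH^n(A^0)$ and $HC^n(A^0)$ are the ordinary Hochschild cohomology (with coefficients in the dual $(A^0)^*$) and ordinary cyclic cohomology of the ungraded algebra $A^0$, i.e. the cohomologies of $(\mathrm{Hom}_k((A^0)^{\otimes *+1},k),b)$ and of $\bigoplus_{p+q=n,\,0\le p\le q}\mathrm{Hom}_k((A^0)^{\otimes q-p+1},k)$ with differential $b+B$. *)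

theory Defs
  imports Complex_Main "HOL-Library.Function_Algebras" "HOL-Library.Set_Algebras"
begin

section \<open>Differential graded algebras\<close>

text \<open>
  The carrier is a type of sort \<open>{ring, monoid_mult}\<close> rather than \<open>ring_1\<close>,
  so that the zero algebra is not excluded.
\<close>

locale dga = vector_space scale
  for scale :: "'k::field_char_0 \<Rightarrow> 'a::{ring, monoid_mult} \<Rightarrow> 'a" +
  fixes A :: "nat \<Rightarrow> 'a set"
    and \<phi> :: "'a \<Rightarrow> 'a"
  assumes scale_mult_left: "scale c x * y = scale c (x * y)"
    and scale_mult_right: "x * scale c y = scale c (x * y)"
    and subspace_component: "subspace (A m)"
    and direct_sum:
      "\<exists>!h. (\<forall>m. h m \<in> A m) \<and> finite {m. h m \<noteq> 0} \<and> x = (\<Sum>m | h m \<noteq> 0. h m)"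
    and one_component: "1 \<in> A 0"
    and mult_component: "x \<in> A l \<Longrightarrow> y \<in> A m \<Longrightarrow> x * y \<in> A (l + m)"
    and linear_differential: "Vector_Spaces.linear scale scale \<phi>"
    and differential_component: "x \<in> A (Suc m) \<Longrightarrow> \<phi> x \<in> A m"
    and differential_component_0: "x \<in> A 0 \<Longrightarrow> \<phi> x = 0"
    and differential_square: "\<phi> (\<phi> x) = 0"
    and Leibniz: "x \<in> A m \<Longrightarrow> \<phi> (x * y) = \<phi> x * y + scale ((- 1) ^ m) (x * \<phi> y)"

text \<open>The zero element is homogeneous of every degree and gets degree \<open>0\<close> here.\<close>

definition degree_of :: "(nat \<Rightarrow> 'a set) \<Rightarrow> 'a \<Rightarrow> nat" where
  "degree_of A x = (LEAST m. x \<in> A m)"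


section \<open>Cochains\<close>

text \<open>
  A linear functional on a tensor product \<open>V\<^sub>0 \<otimes> \<dots> \<otimes> V\<^sub>n\<close> is given by its values on elementary
  tensors, i.e. by a multilinear function of \<open>[a\<^sub>0, \<dots>, a\<^sub>n]\<close> with \<open>a\<^sub>i \<in> V\<^sub>i\<close>.
  A functional on \<open>(A\<^sup>\<otimes>\<^sup>n\<^sup>+\<^sup>1)\<^sup>m\<close>, the direct sum of the \<open>A\<^sup>d\<^sup>0 \<otimes> \<dots> \<otimes> A\<^sup>d\<^sup>n\<close> over all
  \<open>d\<^sub>0 + \<dots> + d\<^sub>n = m\<close>, is a function on the tuples of homogeneous elements of total degree \<open>m\<close> that is
  multilinear for each such choice of degrees.  Cochains are functions on lists; so that
  they are determined by the values that matter, they vanish on all other lists.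
\<close>

definition multilinear_on ::
  "('k::field \<Rightarrow> 'a::ab_group_add \<Rightarrow> 'a) \<Rightarrow> 'a set list \<Rightarrow> ('a list \<Rightarrow> 'k) \<Rightarrow> bool" where
  "multilinear_on scale Vs f \<longleftrightarrow>
    (\<forall>as \<in> listset Vs. \<forall>i < length Vs. \<forall>x \<in> Vs ! i. \<forall>y \<in> Vs ! i. \<forall>c.
      f (as[i := x + y]) = f (as[i := x]) + f (as[i := y]) \<and>
      f (as[i := scale c x]) = c * f (as[i := x]))"

definition degree_lists :: "nat \<Rightarrow> nat \<Rightarrow> nat list set" where
  "degree_lists m n = {ds. length ds = Suc n \<and> sum_list ds = m}"

definition graded_tuples :: "(nat \<Rightarrow> 'a set) \<Rightarrow> nat \<Rightarrow> nat \<Rightarrow> 'a list set" where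
  "graded_tuples A m n = (\<Union>ds \<in> degree_lists m n. listset (map A ds))"

text \<open>\<open>C\<^sup>n(A)\<^sup>m\<close> is \<open>graded_cochains scale A m n\<close>.\<close>

definition graded_cochains ::
  "('k::field \<Rightarrow> 'a::ab_group_add \<Rightarrow> 'a) \<Rightarrow> (nat \<Rightarrow> 'a set) \<Rightarrow> nat \<Rightarrow> nat \<Rightarrow> ('a list \<Rightarrow> 'k) set" where
  "graded_cochains scale A m n =
    {f. (\<forall>ds \<in> degree_lists m n. multilinear_on scale (map A ds) f) \<and>
        (\<forall>as. as \<notin> graded_tuples A m n \<longrightarrow> f as = 0)}"

text \<open>The ungraded analogues, for an algebra given as a subset \<open>S\<close> of the ambient type.\<close>

definition tuples :: "'a set \<Rightarrow> nat \<Rightarrow> 'a list set" where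
  "tuples S n = listset (replicate (Suc n) S)"

definition ungraded_cochains ::
  "('k::field \<Rightarrow> 'a::ab_group_add \<Rightarrow> 'a) \<Rightarrow> 'a set \<Rightarrow> nat \<Rightarrow> ('a list \<Rightarrow> 'k) set" where
  "ungraded_cochains scale S n =
    {f. multilinear_on scale (replicate (Suc n) S) f \<and> (\<forall>as. as \<notin> tuples S n \<longrightarrow> f as = 0)}"


section \<open>Operators on cochains\<close>

text \<open>
  The operators take a degree function \<open>deg\<close> and the sets \<open>T n\<close> of admissible
  tuples \<open>[a\<^sub>0, \<dots>, a\<^sub>n]\<close>.  The graded case uses \<open>degree_of A\<close> and \<open>graded_tuples A m\<close>, the ungraded one
  the zero function and \<open>tuples S\<close>.  The index \<open>n\<close> of an operator is the one of its
  argument for \<open>b\<close>, \<open>\<tau>\<close>, \<open>N\<close>, \<open>B\<close>, \<open>\<delta>\<close>, and the one of its value for \<open>s\<close>.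
\<close>

text \<open>The sign \<open>(-1)\<^sup>n\<^sup>+\<^sup>\<gamma>\<close> for \<open>as = [a\<^sub>0, \<dots>, a\<^sub>n]\<close> and \<open>\<gamma> = |a\<^sub>n|(|a\<^sub>0| + \<dots> + |a\<^sub>n\<^sub>-\<^sub>1|)\<close>.\<close>

definition cyclic_sign :: "('a \<Rightarrow> nat) \<Rightarrow> 'a list \<Rightarrow> 'k::field" where
  "cyclic_sign deg as =
    (- 1) ^ (length as - 1 + deg (last as) * sum_list (map deg (butlast as)))"

definition multiply_at :: "nat \<Rightarrow> 'a::times list \<Rightarrow> 'a list" where
  "multiply_at i as = take i as @ (as ! i * as ! Suc i) # drop (i + 2) as"

definition op_b ::
  "('a::times \<Rightarrow> nat) \<Rightarrow> (nat \<Rightarrow> 'a list set) \<Rightarrow> nat \<Rightarrow> ('a list \<Rightarrow> 'k::field) \<Rightarrow> 'a list \<Rightarrow> 'k" where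
  "op_b deg T n f = (\<lambda>as. if as \<in> T (Suc n)
     then (\<Sum>i\<le>n. (- 1) ^ i * f (multiply_at i as))
          + cyclic_sign deg as * f ((last as * hd as) # butlast (tl as))
     else 0)"

definition op_tau ::
  "('a \<Rightarrow> nat) \<Rightarrow> (nat \<Rightarrow> 'a list set) \<Rightarrow> nat \<Rightarrow> ('a list \<Rightarrow> 'k::field) \<Rightarrow> 'a list \<Rightarrow> 'k" where
  "op_tau deg T n f =
    (\<lambda>as. if as \<in> T n then cyclic_sign deg as * f (last as # butlast as) else 0)"

definition op_N ::
  "('a \<Rightarrow> nat) \<Rightarrow> (nat \<Rightarrow> 'a list set) \<Rightarrow> nat \<Rightarrow> ('a list \<Rightarrow> 'k::field) \<Rightarrow> 'a list \<Rightarrow> 'k" where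
  "op_N deg T n f = (\<Sum>i\<le>n. (op_tau deg T n ^^ i) f)"

definition op_s ::
  "(nat \<Rightarrow> 'a::one list set) \<Rightarrow> nat \<Rightarrow> ('a list \<Rightarrow> 'k::field) \<Rightarrow> 'a list \<Rightarrow> 'k" where
  "op_s T n f = (\<lambda>as. if as \<in> T n then (- 1) ^ n * f (as @ [1]) else 0)"

fun op_B ::
  "('a::one \<Rightarrow> nat) \<Rightarrow> (nat \<Rightarrow> 'a list set) \<Rightarrow> nat \<Rightarrow> ('a list \<Rightarrow> 'k::field) \<Rightarrow> 'a list \<Rightarrow> 'k" where
  "op_B deg T 0 f = 0"
| "op_B deg T (Suc n) f = op_N deg T n (op_s T n (f - op_tau deg T (Suc n) f))"

text \<open>\<open>\<delta>\<close> from \<open>C\<^sup>n(A)\<^sup>m\<close> to \<open>C\<^sup>n(A)\<^sup>m\<^sup>+\<^sup>1\<close>\<close>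

definition op_delta ::
  "(nat \<Rightarrow> 'a set) \<Rightarrow> ('a \<Rightarrow> 'a) \<Rightarrow> nat \<Rightarrow> nat \<Rightarrow> ('a list \<Rightarrow> 'k::field) \<Rightarrow> 'a list \<Rightarrow> 'k" where
  "op_delta A \<phi> m n f = (\<lambda>as. if as \<in> graded_tuples A (Suc m) n
     then (- 1) ^ m *
       (\<Sum>i\<le>n. (- 1) ^ sum_list (map (degree_of A) (take i as)) * f (as[i := \<phi> (as ! i)]))
     else 0)"


section \<open>Cochain complexes and their cohomology\<close>

record ('k, 'v) cochain_complex =
  cochains :: "nat \<Rightarrow> 'v set"
  differential :: "nat \<Rightarrow> 'v \<Rightarrow> 'v"
  cochain_scale :: "'k \<Rightarrow> 'v \<Rightarrow> 'v"

definition cocycles :: "('k, 'v::ab_group_add) cochain_complex \<Rightarrow> nat \<Rightarrow> 'v set" where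
  "cocycles X n = {x \<in> cochains X n. differential X n x = 0}"

fun coboundaries :: "('k, 'v::ab_group_add) cochain_complex \<Rightarrow> nat \<Rightarrow> 'v set" where
  "coboundaries X 0 = {0}"
| "coboundaries X (Suc n) = differential X n ` cochains X n"

definition cohomology_class :: "('k, 'v::ab_group_add) cochain_complex \<Rightarrow> nat \<Rightarrow> 'v \<Rightarrow> 'v set" where
  "cohomology_class X n x = x +o coboundaries X n"

definition cohomology :: "('k, 'v::ab_group_add) cochain_complex \<Rightarrow> nat \<Rightarrow> 'v set set" where
  "cohomology X n = cohomology_class X n ` cocycles X n"

text \<open>
  Classes are cosets, so they are added by addition of sets.  Elementwise scaling alone would
  turn a coset into \<open>{0}\<close> for the scalar \<open>0\<close>.
\<close>

definition class_scale ::
  "('k, 'v::ab_group_add) cochain_complex \<Rightarrow> nat \<Rightarrow> 'k \<Rightarrow> 'v set \<Rightarrow> 'v set" where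
  "class_scale X n c P = (\<Union>x \<in> P. cohomology_class X n (cochain_scale X c x))"

definition cohomology_linear ::
  "('k, 'v::ab_group_add) cochain_complex \<Rightarrow> nat \<Rightarrow> ('k, 'w::ab_group_add) cochain_complex \<Rightarrow> nat
    \<Rightarrow> ('v set \<Rightarrow> 'w set) \<Rightarrow> bool" where
  "cohomology_linear X m Y n F \<longleftrightarrow>
    (\<forall>P \<in> cohomology X m. F P \<in> cohomology Y n) \<and>
    (\<forall>P \<in> cohomology X m. \<forall>Q \<in> cohomology X m. F (P + Q) = F P + F Q) \<and>
    (\<forall>c. \<forall>P \<in> cohomology X m. F (class_scale X m c P) = class_scale Y n c (F P))"


section \<open>The complexes\<close>

definition fun_scale :: "'k::times \<Rightarrow> ('x \<Rightarrow> 'k) \<Rightarrow> 'x \<Rightarrow> 'k" where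
  "fun_scale c f = (\<lambda>x. c * f x)"

definition family_scale :: "'k::times \<Rightarrow> (nat \<Rightarrow> 'x \<Rightarrow> 'k) \<Rightarrow> nat \<Rightarrow> 'x \<Rightarrow> 'k" where
  "family_scale c F = (\<lambda>p. fun_scale c (F p))"

text \<open>
  The cyclic complex formed from spaces \<open>C n\<close> and operators \<open>b n\<close>, \<open>B n\<close> on \<open>C n\<close>: a
  cochain \<open>F\<close> of degree \<open>m\<close> has the components \<open>F p\<close> in \<open>C (q - p)\<close> for \<open>p + q = m\<close> and \<open>p \<le> q\<close>, so
  that \<open>q - p = m - 2p\<close>.  The operator \<open>b\<close> goes from \<open>(p, q)\<close> to \<open>(p, q + 1)\<close> and \<open>B\<close> to \<open>(p + 1, q)\<close>.
\<close>

definition cyclic_complex ::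
  "(nat \<Rightarrow> ('x \<Rightarrow> 'k::field) set) \<Rightarrow> (nat \<Rightarrow> ('x \<Rightarrow> 'k) \<Rightarrow> 'x \<Rightarrow> 'k) \<Rightarrow>
    (nat \<Rightarrow> ('x \<Rightarrow> 'k) \<Rightarrow> 'x \<Rightarrow> 'k) \<Rightarrow> ('k, nat \<Rightarrow> 'x \<Rightarrow> 'k) cochain_complex" where
  "cyclic_complex C b B = \<lparr>
     cochains = (\<lambda>m. {F. \<forall>p. if 2 * p \<le> m then F p \<in> C (m - 2 * p) else F p = 0}),
     differential = (\<lambda>m F p.
       (if 2 * p \<le> m then b (m - 2 * p) (F p) else 0) +
       (if 1 \<le> p \<and> 2 * (p - 1) \<le> m then B (m - 2 * (p - 1)) (F (p - 1)) else 0)),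
     cochain_scale = family_scale\<rparr>"

text \<open>
  In degree \<open>n\<close> a cochain \<open>F\<close> of the total complex has the components \<open>F p\<close> in
  \<open>C\<^sup>p(A)\<^sup>q\<close> for \<open>p + q = n\<close>.
\<close>

definition HHdg_complex ::
  "('k::field \<Rightarrow> 'a::{ring, monoid_mult} \<Rightarrow> 'a) \<Rightarrow> (nat \<Rightarrow> 'a set) \<Rightarrow> ('a \<Rightarrow> 'a)
    \<Rightarrow> ('k, nat \<Rightarrow> 'a list \<Rightarrow> 'k) cochain_complex" where
  "HHdg_complex scale A \<phi> = \<lparr>
     cochains =
       (\<lambda>n. {F. \<forall>p. if p \<le> n then F p \<in> graded_cochains scale A (n - p) p else F p = 0}),
     differential = (\<lambda>n F p.
       (if 1 \<le> p \<and> p \<le> Suc n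
        then op_b (degree_of A) (graded_tuples A (Suc n - p)) (p - 1) (F (p - 1)) else 0) +
       (if p \<le> n then fun_scale ((- 1) ^ p) (op_delta A \<phi> (n - p) p (F p)) else 0)),
     cochain_scale = family_scale\<rparr>"

text \<open>\<open>HHP\<^sup>m\<^sub>n(A)\<close> is the \<open>m\<close>-th cohomology of \<open>HHP_complex scale A n\<close>, and similarly for \<open>HCP\<close>.\<close>

definition HHP_complex ::
  "('k::field \<Rightarrow> 'a::{ring, monoid_mult} \<Rightarrow> 'a) \<Rightarrow> (nat \<Rightarrow> 'a set) \<Rightarrow> nat
    \<Rightarrow> ('k, 'a list \<Rightarrow> 'k) cochain_complex" where
  "HHP_complex scale A n = \<lparr>
     cochains = graded_cochains scale A n,
     differential = op_b (degree_of A) (graded_tuples A n),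
     cochain_scale = fun_scale\<rparr>"

definition HCP_complex ::
  "('k::field \<Rightarrow> 'a::{ring, monoid_mult} \<Rightarrow> 'a) \<Rightarrow> (nat \<Rightarrow> 'a set) \<Rightarrow> nat
    \<Rightarrow> ('k, nat \<Rightarrow> 'a list \<Rightarrow> 'k) cochain_complex" where
  "HCP_complex scale A n = cyclic_complex (graded_cochains scale A n)
     (op_b (degree_of A) (graded_tuples A n)) (op_B (degree_of A) (graded_tuples A n))"

definition HH_complex ::
  "('k::field \<Rightarrow> 'a::{ring, monoid_mult} \<Rightarrow> 'a) \<Rightarrow> 'a set \<Rightarrow> ('k, 'a list \<Rightarrow> 'k) cochain_complex" where
  "HH_complex scale S = \<lparr>
     cochains = ungraded_cochains scale S,
     differential = op_b (\<lambda>_. 0) (tuples S),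
     cochain_scale = fun_scale\<rparr>"

definition HC_complex ::
  "('k::field \<Rightarrow> 'a::{ring, monoid_mult} \<Rightarrow> 'a) \<Rightarrow> 'a set
    \<Rightarrow> ('k, nat \<Rightarrow> 'a list \<Rightarrow> 'k) cochain_complex" where
  "HC_complex scale S = cyclic_complex (ungraded_cochains scale S)
     (op_b (\<lambda>_. 0) (tuples S)) (op_B (\<lambda>_. 0) (tuples S))"

text \<open>
  Restriction of a functional along \<open>S\<^sup>\<otimes>\<^sup>n\<^sup>+\<^sup>1 \<rightarrow> A\<^sup>\<otimes>\<^sup>n\<^sup>+\<^sup>1\<close>, for a subalgebra \<open>S\<close> of \<open>A\<close>
\<close>

definition restrict_cochain ::
  "'a set \<Rightarrow> nat \<Rightarrow> ('a list \<Rightarrow> 'k::zero) \<Rightarrow> 'a list \<Rightarrow> 'k" where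
  "restrict_cochain S n f = (\<lambda>as. if as \<in> tuples S n then f as else 0)"

end

theory Submission
  imports Defs
begin

text \<open>
  Each of the three maps comes from a cochain map, and a cochain map of complexes of vector spaces
  sends cocycles to cocycles and coboundaries to coboundaries, hence induces a linear map of
  cohomology spaces (\<open>cochain_map_induces_cohomology_linear\<close>).

  For \<open>HH\<^sub>d\<^sub>g\<close> the cochain map keeps the component in \<open>C\<^sup>n(A)\<^sup>0\<close>, the edge of the double complex
  where the internal degree is \<open>0\<close>.  Every tuple of total degree \<open>0\<close> consists of elements of \<open>A\<^sup>0\<close>,
  so \<open>C\<^sup>n(A)\<^sup>0\<close> is the space of Hochschild cochains of \<open>A\<^sup>0\<close>, and the Koszul signs in \<open>b\<close> are
  trivial there.  The differential \<open>\<delta>\<close> raises the internal degree, so its values never lie on this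
  edge: the edge component of the total differential of \<open>F\<close> is \<open>b\<close> of the edge component of \<open>F\<close>.

  For \<open>HCP\<close> and \<open>HC\<close> the cochain map keeps the component \<open>p = 0\<close> of the cyclic double complex.
  The operator \<open>B\<close> raises \<open>p\<close>, so that the component \<open>p = 0\<close> of \<open>(b + B) F\<close> is \<open>b\<close> of the
  component \<open>p = 0\<close> of \<open>F\<close> (\<open>cyclic_to_b_complex\<close>).
\<close>


section \<open>Complexes of vector spaces and their morphisms\<close>

text \<open>
  Linearity is what makes the coboundaries a subspace, and so the cosets of the coboundaries closed
  under the addition of sets and under \<open>class_scale\<close>.
\<close>

locale linear_complex = vector_space "cochain_scale X"
  for X :: "('k::field, 'v::ab_group_add) cochain_complex" +
  assumes subspace_cochains: "subspace (cochains X n)"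
    and linear_differential:
      "Vector_Spaces.linear (cochain_scale X) (cochain_scale X) (differential X n)"
begin

lemma subspace_coboundaries: "subspace (coboundaries X n)"
proof (cases n)
  case 0
  then show ?thesis by (simp add: subspace_0 subspace_single_0)
next
  case (Suc m)
  interpret d: Vector_Spaces.linear "cochain_scale X" "cochain_scale X" "differential X m"
    by (rule linear_differential)
  show ?thesis using d.subspace_image[OF subspace_cochains] Suc by simp
qed

lemma mem_cohomology_class: "y \<in> cohomology_class X n x \<longleftrightarrow> y - x \<in> coboundaries X n"
  by (auto simp: cohomology_class_def elt_set_plus_def algebra_simps intro!: bexI[of _ "y - x"])

lemma cohomology_class_eq_iff:
  "cohomology_class X n x = cohomology_class X n y \<longleftrightarrow> x - y \<in> coboundaries X n"
proof
  assume "cohomology_class X n x = cohomology_class X n y"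
  moreover have "x \<in> cohomology_class X n x"
    by (simp add: mem_cohomology_class subspace_0[OF subspace_coboundaries])
  ultimately show "x - y \<in> coboundaries X n" by (simp add: mem_cohomology_class)
next
  assume xy: "x - y \<in> coboundaries X n"
  have "z - x \<in> coboundaries X n \<longleftrightarrow> z - y \<in> coboundaries X n" for z
    using subspace_add[OF subspace_coboundaries, of "z - x" n "x - y"]
      subspace_diff[OF subspace_coboundaries, of "z - y" n "x - y"] xy by auto
  then show "cohomology_class X n x = cohomology_class X n y"
    by (auto simp: mem_cohomology_class)
qed

lemma cohomology_class_add:
  "cohomology_class X n x + cohomology_class X n y = cohomology_class X n (x + y)"
proof (intro set_eqI iffI)
  fix z assume "z \<in> cohomology_class X n x + cohomology_class X n y"
  then obtain u v where uv: "z = u + v" "u - x \<in> coboundaries X n" "v - y \<in> coboundaries X n"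
    by (auto simp: set_plus_def mem_cohomology_class)
  have eq: "z - (x + y) = (u - x) + (v - y)" by (simp add: uv)
  show "z \<in> cohomology_class X n (x + y)"
    unfolding mem_cohomology_class eq by (intro subspace_add subspace_coboundaries uv)
next
  fix z assume "z \<in> cohomology_class X n (x + y)"
  then have "z - y \<in> cohomology_class X n x" by (simp add: mem_cohomology_class algebra_simps)
  moreover have "y \<in> cohomology_class X n y"
    by (simp add: mem_cohomology_class subspace_0[OF subspace_coboundaries])
  ultimately have "(z - y) + y \<in> cohomology_class X n x + cohomology_class X n y"
    by (rule set_plus_intro)
  then show "z \<in> cohomology_class X n x + cohomology_class X n y" by simp
qed

lemma class_scale_cohomology_class:
  "class_scale X n c (cohomology_class X n x) = cohomology_class X n (cochain_scale X c x)"
proof -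
  have "cohomology_class X n (cochain_scale X c y) = cohomology_class X n (cochain_scale X c x)"
    if "y \<in> cohomology_class X n x" for y
    using subspace_scale[OF subspace_coboundaries, of "y - x" n c] that
    by (simp add: cohomology_class_eq_iff mem_cohomology_class scale_right_diff_distrib)
  moreover have "x \<in> cohomology_class X n x"
    by (simp add: mem_cohomology_class subspace_0[OF subspace_coboundaries])
  ultimately show ?thesis unfolding class_scale_def by blast
qed

end

text \<open>
  The induced map sends a coset to the union of the cosets of the images of its members.  These
  all coincide, so the definition needs no choice of a representative.
\<close>

lemma cochain_map_induces_cohomology_linear:
  assumes X: "linear_complex X" and Y: "linear_complex Y"
    and linear: "\<And>n. Vector_Spaces.linear (cochain_scale X) (cochain_scale Y) (g n)"
    and cochains: "\<And>n x. x \<in> cochains X n \<Longrightarrow> g n x \<in> cochains Y n"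
    and commute: "\<And>n x. x \<in> cochains X n \<Longrightarrow>
      g (Suc n) (differential X n x) = differential Y n (g n x)"
  shows "\<exists>F. cohomology_linear X n Y n F \<and>
    (\<forall>x \<in> cocycles X n. F (cohomology_class X n x) = cohomology_class Y n (g n x))"
proof -
  interpret X: linear_complex X by (rule X)
  interpret Y: linear_complex Y by (rule Y)
  interpret g: Vector_Spaces.linear "cochain_scale X" "cochain_scale Y" "g k" for k
    by (rule linear)
  define F where "F P = (\<Union>x \<in> P. cohomology_class Y n (g n x))" for P
  have cocycles: "g n x \<in> cocycles Y n" if "x \<in> cocycles X n" for x
    using that cochains commute[of x n] g.zero by (simp add: cocycles_def)
  have coboundaries: "g n x \<in> coboundaries Y n" if "x \<in> coboundaries X n" for x
    using that g.zero cochains commute by (cases n) auto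
  have F: "F (cohomology_class X n x) = cohomology_class Y n (g n x)" for x
  proof -
    have "cohomology_class Y n (g n y) = cohomology_class Y n (g n x)"
      if "y \<in> cohomology_class X n x" for y
      using coboundaries[of "y - x"] that
      by (simp add: Y.cohomology_class_eq_iff X.mem_cohomology_class g.diff)
    moreover have "x \<in> cohomology_class X n x"
      by (simp add: X.mem_cohomology_class X.subspace_0[OF X.subspace_coboundaries])
    ultimately show ?thesis unfolding F_def by blast
  qed
  have "cohomology_linear X n Y n F"
    unfolding cohomology_linear_def
    using cocycles
    by (auto simp: cohomology_def F X.cohomology_class_add Y.cohomology_class_add
        X.class_scale_cohomology_class Y.class_scale_cohomology_class g.add g.scale)
  with F show ?thesis by blast
qed


section \<open>The complexes of cochains\<close>

lemma vector_space_fun_scale: "vector_space (fun_scale :: 'k::field \<Rightarrow> ('x \<Rightarrow> 'k) \<Rightarrow> 'x \<Rightarrow> 'k)"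
  by unfold_locales (auto simp: fun_scale_def fun_eq_iff algebra_simps)

lemma vector_space_family_scale:
  "vector_space (family_scale :: 'k::field \<Rightarrow> (nat \<Rightarrow> 'x \<Rightarrow> 'k) \<Rightarrow> nat \<Rightarrow> 'x \<Rightarrow> 'k)"
  by unfold_locales (auto simp: family_scale_def fun_scale_def fun_eq_iff algebra_simps)

interpretation fun_space: vector_space
  "fun_scale :: 'k::field \<Rightarrow> ('x \<Rightarrow> 'k) \<Rightarrow> 'x \<Rightarrow> 'k"
  by (rule vector_space_fun_scale)

interpretation family_space: vector_space
  "family_scale :: 'k::field \<Rightarrow> (nat \<Rightarrow> 'x \<Rightarrow> 'k) \<Rightarrow> nat \<Rightarrow> 'x \<Rightarrow> 'k"
  by (rule vector_space_family_scale)

lemma vector_space_linearI: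
  assumes "vector_space s" "vector_space t"
    and "\<And>x y. f (x + y) = f x + f y" "\<And>c x. f (s c x) = t c (f x)"
  shows "Vector_Spaces.linear s t f"
  using assms by (simp add: Vector_Spaces.linear_iff)

abbreviation fun_linear :: "(('x \<Rightarrow> 'k::field) \<Rightarrow> 'y \<Rightarrow> 'k) \<Rightarrow> bool" where
  "fun_linear \<equiv> Vector_Spaces.linear fun_scale fun_scale"

lemma fun_linearI:
  assumes "\<And>f g x. d (f + g) x = d f x + d g x" "\<And>c f x. d (fun_scale c f) x = c * d f x"
  shows "fun_linear d"
  using assms
  by (intro vector_space_linearI vector_space_fun_scale)
    (auto simp: fun_eq_iff fun_scale_def)

lemma linear_op_b: "fun_linear (op_b deg T n)"
  by (rule fun_linearI)
    (auto simp: op_b_def fun_scale_def algebra_simps sum.distrib sum_distrib_left)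

lemma linear_op_tau: "fun_linear (op_tau deg T n)"
  by (rule fun_linearI) (auto simp: op_tau_def fun_scale_def algebra_simps)

lemma linear_op_s: "fun_linear (op_s T n)"
  by (rule fun_linearI) (auto simp: op_s_def fun_scale_def algebra_simps)

lemma linear_op_delta: "fun_linear (op_delta A \<phi> m n)"
  by (rule fun_linearI)
    (auto simp: op_delta_def fun_scale_def algebra_simps sum.distrib sum_distrib_left)

lemma linear_op_N:
  fixes deg :: "'a \<Rightarrow> nat"
  shows "fun_linear (op_N deg T n :: ('a list \<Rightarrow> 'b::field) \<Rightarrow> _)"
proof -
  have "fun_linear ((op_tau deg T n ^^ i) :: ('a list \<Rightarrow> 'b) \<Rightarrow> _)" for i
  proof (induction i)
    case 0
    show ?case by (rule fun_linearI) (auto simp: fun_scale_def)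
  next
    case (Suc i)
    show ?case
      using Vector_Spaces.linear_compose[OF Suc linear_op_tau[of deg T n]]
      by (simp only: funpow.simps)
  qed
  then show ?thesis
    unfolding op_N_def
    by (intro vector_space_pair.linear_compose_sum vector_space_pair.intro
        vector_space_fun_scale ballI)
qed

lemma linear_op_B:
  fixes deg :: "'a::one \<Rightarrow> nat"
  shows "fun_linear (op_B deg T n :: ('a list \<Rightarrow> 'b::field) \<Rightarrow> _)"
proof (cases n)
  case 0
  then show ?thesis by (auto intro: fun_linearI)
next
  case (Suc m)
  have tau: "fun_linear (\<lambda>f :: 'a list \<Rightarrow> 'b. f - op_tau deg T (Suc m) f)"
    by (rule fun_linearI) (auto simp: op_tau_def fun_scale_def algebra_simps)
  have "(op_B deg T (Suc m) :: ('a list \<Rightarrow> 'b) \<Rightarrow> _) =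
      (op_N deg T m \<circ> op_s T m) \<circ> (\<lambda>f. f - op_tau deg T (Suc m) f)"
    by (rule ext) simp
  then show ?thesis
    using Vector_Spaces.linear_compose[OF tau
        Vector_Spaces.linear_compose[OF linear_op_s[of T m] linear_op_N[of deg T m]]] Suc
    by simp
qed

lemma multilinear_on_add:
  "multilinear_on sc Vs f \<Longrightarrow> multilinear_on sc Vs g \<Longrightarrow> multilinear_on sc Vs (f + g)"
  unfolding multilinear_on_def by (simp add: algebra_simps)

lemma multilinear_on_fun_scale:
  "multilinear_on sc Vs f \<Longrightarrow> multilinear_on sc Vs (fun_scale c f)"
  unfolding multilinear_on_def by (simp add: fun_scale_def algebra_simps)

lemma multilinear_on_0: "multilinear_on sc Vs 0"
  unfolding multilinear_on_def by simp

lemma subspace_graded_cochains: "fun_space.subspace (graded_cochains sc A m n)"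
  unfolding graded_cochains_def
  by (rule fun_space.subspaceI)
    (auto simp: multilinear_on_add multilinear_on_fun_scale multilinear_on_0,
      auto simp: fun_scale_def)

lemma subspace_ungraded_cochains: "fun_space.subspace (ungraded_cochains sc S n)"
  unfolding ungraded_cochains_def
  by (rule fun_space.subspaceI)
    (auto simp: multilinear_on_add multilinear_on_fun_scale multilinear_on_0,
      auto simp: fun_scale_def)

lemma linear_complex_functions:
  fixes C :: "nat \<Rightarrow> ('x \<Rightarrow> 'k::field) set"
  assumes "\<And>n. fun_space.subspace (C n)" "\<And>n. fun_linear (d n)"
  shows "linear_complex \<lparr>cochains = C, differential = d, cochain_scale = fun_scale\<rparr>"
  using assms unfolding linear_complex_def linear_complex_axioms_def
  by (simp add: vector_space_fun_scale)

lemma subspace_families: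
  assumes "\<And>p. P p \<Longrightarrow> fun_space.subspace (C p)"
  shows "family_space.subspace {F. \<forall>p. if P p then F p \<in> C p else F p = 0}"
  using assms
  by (auto intro!: family_space.subspaceI simp: family_scale_def fun_space.subspace_0
      fun_space.subspace_add fun_space.subspace_scale split: if_splits)

lemma linear_complex_cyclic:
  fixes C :: "nat \<Rightarrow> ('x \<Rightarrow> 'k::field) set"
  assumes C: "\<And>n. fun_space.subspace (C n)"
    and b: "\<And>n. fun_linear (b n)" and B: "\<And>n. fun_linear (B n)"
  shows "linear_complex (cyclic_complex C b B)"
proof -
  interpret b: Vector_Spaces.linear fun_scale fun_scale "b n" for n by (rule b)
  interpret B: Vector_Spaces.linear fun_scale fun_scale "B n" for n by (rule B)
  have "Vector_Spaces.linear family_scale family_scale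
      (differential (cyclic_complex C b B) m)" for m
    by (intro vector_space_linearI vector_space_family_scale)
      (auto simp: cyclic_complex_def family_scale_def b.add b.scale B.add B.scale
        fun_space.scale_right_distrib intro!: ext)
  then show ?thesis
    unfolding linear_complex_def linear_complex_axioms_def
    by (simp add: cyclic_complex_def vector_space_family_scale subspace_families C)
qed

lemma linear_complex_HHdg: "linear_complex (HHdg_complex sc A \<phi>)"
proof -
  interpret b: Vector_Spaces.linear fun_scale fun_scale "op_b deg T n" for deg T n
    by (rule linear_op_b)
  interpret delta: Vector_Spaces.linear fun_scale fun_scale "op_delta A \<phi> m n" for m n
    by (rule linear_op_delta)
  have "Vector_Spaces.linear family_scale family_scale
      (differential (HHdg_complex sc A \<phi>) n)" for n
    by (intro vector_space_linearI vector_space_family_scale)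
      (auto simp: HHdg_complex_def family_scale_def b.add b.scale delta.add delta.scale
        fun_space.scale_right_distrib mult.commute intro!: ext)
  then show ?thesis
    unfolding linear_complex_def linear_complex_axioms_def
    by (simp add: HHdg_complex_def vector_space_family_scale subspace_families
        subspace_graded_cochains)
qed


section \<open>From cyclic to Hochschild cohomology\<close>

text \<open>
  Since \<open>B\<close> only maps into columns with \<open>p \<ge> 1\<close>, these columns form a subcomplex of the double
  complex, and projecting onto the column \<open>p = 0\<close> is passing to the quotient.
\<close>

lemma cyclic_to_b_complex:
  fixes C :: "nat \<Rightarrow> ('x \<Rightarrow> 'k::field) set"
    and b :: "nat \<Rightarrow> ('x \<Rightarrow> 'k) \<Rightarrow> 'x \<Rightarrow> 'k"
  defines "Y \<equiv> \<lparr>cochains = C, differential = b, cochain_scale = fun_scale\<rparr>"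
  assumes C: "\<And>n. fun_space.subspace (C n)"
    and b: "\<And>n. fun_linear (b n)" and B: "\<And>n. fun_linear (B n)"
  shows "\<exists>F. cohomology_linear (cyclic_complex C b B) n Y n F \<and>
    (\<forall>f \<in> cocycles (cyclic_complex C b B) n.
      F (cohomology_class (cyclic_complex C b B) n f) = cohomology_class Y n (f 0))"
proof -
  have "linear_complex Y"
    unfolding Y_def by (intro linear_complex_functions C b)
  moreover have "Vector_Spaces.linear (cochain_scale (cyclic_complex C b B)) (cochain_scale Y)
      (\<lambda>F. F 0)"
    by (intro vector_space_linearI)
      (auto simp: Y_def cyclic_complex_def vector_space_fun_scale vector_space_family_scale
        family_scale_def)
  ultimately show ?thesis
    by (intro cochain_map_induces_cohomology_linear[where g = "\<lambda>_ F. F 0"]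
        linear_complex_cyclic C b B)
      (auto simp: Y_def cyclic_complex_def dest: spec[of _ 0])
qed


section \<open>From the differential graded algebra to its degree-zero part\<close>

lemma mem_tuples_iff: "as \<in> tuples S n \<longleftrightarrow> length as = Suc n \<and> set as \<subseteq> S"
proof -
  have "as \<in> listset (replicate k S) \<longleftrightarrow> length as = k \<and> set as \<subseteq> S" for k
    by (induction k arbitrary: as) (auto simp: set_Cons_def length_Suc_conv)
  then show ?thesis unfolding tuples_def by blast
qed

lemma degree_lists_0: "degree_lists 0 n = {replicate (Suc n) 0}"
  unfolding degree_lists_def
  by (auto simp del: replicate.simps intro!: replicate_eqI)

lemma graded_tuples_0: "graded_tuples A 0 n = tuples (A 0) n"
  by (simp add: graded_tuples_def degree_lists_0 tuples_def)

text \<open>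
  The only way to write \<open>0\<close> as a sum of natural numbers is with all summands \<open>0\<close>.  Restricting a
  cochain of internal degree \<open>0\<close> to \<open>A 0\<close> therefore loses nothing.
\<close>

lemma graded_cochains_0: "graded_cochains sc A 0 n = ungraded_cochains sc (A 0) n"
  by (simp add: graded_cochains_def ungraded_cochains_def degree_lists_0 graded_tuples_0)

lemma restrict_cochain_ungraded:
  "f \<in> ungraded_cochains sc S n \<Longrightarrow> restrict_cochain S n f = f"
  by (auto simp: ungraded_cochains_def restrict_cochain_def fun_eq_iff)

lemma linear_restrict_component:
  "Vector_Spaces.linear family_scale fun_scale (\<lambda>F. restrict_cochain S n (F n))"
  by (intro vector_space_linearI vector_space_fun_scale vector_space_family_scale)
    (auto simp: restrict_cochain_def family_scale_def fun_scale_def fun_eq_iff)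

lemma multiply_at_tuples:
  assumes "\<And>x y. x \<in> S \<Longrightarrow> y \<in> S \<Longrightarrow> x * y \<in> S" "as \<in> tuples S (Suc n)" "i \<le> n"
  shows "multiply_at i as \<in> tuples S n"
proof -
  have "as ! i \<in> S" "as ! Suc i \<in> S" using assms(2,3) by (auto simp: mem_tuples_iff)
  then show ?thesis
    using assms unfolding mem_tuples_iff multiply_at_def
    by (auto dest!: in_set_takeD in_set_dropD)
qed

lemma rotate_multiply_tuples:
  assumes "\<And>x y. x \<in> S \<Longrightarrow> y \<in> S \<Longrightarrow> x * y \<in> S" "as \<in> tuples S (Suc n)"
  shows "(last as * hd as) # butlast (tl as) \<in> tuples S n"
proof -
  have "last as \<in> S" "hd as \<in> S" using assms(2) by (cases as; auto simp: mem_tuples_iff)+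
  then show ?thesis
    using assms unfolding mem_tuples_iff
    by (cases as) (auto dest!: in_set_butlastD)
qed

text \<open>
  All elements of \<open>A 0\<close> have \<open>degree_of\<close> zero, whence the cyclic sign reduces to the ungraded one;
  closure of \<open>A 0\<close> under products ensures that \<open>b\<close> evaluates \<open>f\<close> only at tuples that survive
  the restriction.
\<close>

lemma restrict_cochain_op_b:
  fixes A :: "nat \<Rightarrow> 'a::times set" and f :: "'a list \<Rightarrow> 'k::field"
  assumes mult: "\<And>x y. x \<in> A 0 \<Longrightarrow> y \<in> A 0 \<Longrightarrow> x * y \<in> A 0"
  shows "restrict_cochain (A 0) (Suc n) (op_b (degree_of A) (graded_tuples A 0) n f) =
    op_b (\<lambda>_. 0) (tuples (A 0)) n (restrict_cochain (A 0) n f)"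
proof
  fix as
  show "restrict_cochain (A 0) (Suc n) (op_b (degree_of A) (graded_tuples A 0) n f) as =
    op_b (\<lambda>_. 0) (tuples (A 0)) n (restrict_cochain (A 0) n f) as"
  proof (cases "as \<in> tuples (A 0) (Suc n)")
    case False
    then show ?thesis by (simp add: restrict_cochain_def op_b_def)
  next
    case True
    have "last as \<in> A 0" using True by (cases as) (auto simp: mem_tuples_iff)
    then have "degree_of A (last as) = 0" by (simp add: degree_of_def)
    then have "cyclic_sign (degree_of A) as = (cyclic_sign (\<lambda>_. 0) as :: 'k)"
      by (simp add: cyclic_sign_def)
    with True show ?thesis
      using multiply_at_tuples[OF mult True] rotate_multiply_tuples[OF mult True]
      by (simp add: restrict_cochain_def op_b_def graded_tuples_0)
  qed
qed

lemma HHdg_to_HH: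
  assumes "dga sc A \<phi>"
  shows "\<exists>F. cohomology_linear (HHdg_complex sc A \<phi>) n (HH_complex sc (A 0)) n F \<and>
    (\<forall>f \<in> cocycles (HHdg_complex sc A \<phi>) n.
      F (cohomology_class (HHdg_complex sc A \<phi>) n f) =
      cohomology_class (HH_complex sc (A 0)) n (restrict_cochain (A 0) n (f n)))"
proof (rule cochain_map_induces_cohomology_linear
    [where g = "\<lambda>n F. restrict_cochain (A 0) n (F n)"])
  interpret dga sc A \<phi> by (rule assms)
  have mult: "x * y \<in> A 0" if "x \<in> A 0" "y \<in> A 0" for x y
    using mult_component[OF that] by simp
  show "linear_complex (HHdg_complex sc A \<phi>)" by (rule linear_complex_HHdg)
  show "linear_complex (HH_complex sc (A 0))" 
    unfolding HH_complex_def
    by (intro linear_complex_functions subspace_ungraded_cochains linear_op_b)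
  show "Vector_Spaces.linear (cochain_scale (HHdg_complex sc A \<phi>))
      (cochain_scale (HH_complex sc (A 0))) (\<lambda>F. restrict_cochain (A 0) m (F m))" for m
    using linear_restrict_component by (simp add: HHdg_complex_def HH_complex_def)
  fix m F
  assume "F \<in> cochains (HHdg_complex sc A \<phi>) m"
  then have "F m \<in> ungraded_cochains sc (A 0) m"
    by (auto simp: HHdg_complex_def graded_cochains_0 dest: spec[of _ m])
  then show "restrict_cochain (A 0) m (F m) \<in> cochains (HH_complex sc (A 0)) m"
    by (simp add: HH_complex_def restrict_cochain_ungraded)
  \<comment> \<open>The \<open>\<delta>\<close> term of the total differential has no component at \<open>p = m + 1\<close>, where the
    internal degree is \<open>0\<close>.\<close>
  show "restrict_cochain (A 0) (Suc m) (differential (HHdg_complex sc A \<phi>) m F (Suc m)) =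
      differential (HH_complex sc (A 0)) m (restrict_cochain (A 0) m (F m))"
    by (simp add: HHdg_complex_def HH_complex_def restrict_cochain_op_b[of A, OF mult])
qed

theorem corollary4p23:
  fixes scale :: "'k::field_char_0 \<Rightarrow> 'a::{ring, monoid_mult} \<Rightarrow> 'a"
    and A :: "nat \<Rightarrow> 'a set"
    and \<phi> :: "'a \<Rightarrow> 'a"
    and n :: nat
  assumes "dga scale A \<phi>"
  shows
    "(\<exists>F. cohomology_linear (HHdg_complex scale A \<phi>) n (HH_complex scale (A 0)) n F \<and>
       (\<forall>f \<in> cocycles (HHdg_complex scale A \<phi>) n.
          F (cohomology_class (HHdg_complex scale A \<phi>) n f) =
          cohomology_class (HH_complex scale (A 0)) n (restrict_cochain (A 0) n (f n)))) \<and>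
     (\<exists>F. cohomology_linear (HCP_complex scale A n) 0 (HHP_complex scale A n) 0 F \<and>
       (\<forall>f \<in> cocycles (HCP_complex scale A n) 0.
          F (cohomology_class (HCP_complex scale A n) 0 f) =
          cohomology_class (HHP_complex scale A n) 0 (f 0))) \<and>
     (\<exists>F. cohomology_linear (HC_complex scale (A 0)) n (HH_complex scale (A 0)) n F \<and>
       (\<forall>f \<in> cocycles (HC_complex scale (A 0)) n.
          F (cohomology_class (HC_complex scale (A 0)) n f) =
          cohomology_class (HH_complex scale (A 0)) n (f 0)))"
proof (intro conjI)
  show "\<exists>F. cohomology_linear (HHdg_complex scale A \<phi>) n (HH_complex scale (A 0)) n F \<and>
       (\<forall>f \<in> cocycles (HHdg_complex scale A \<phi>) n.
          F (cohomology_class (HHdg_complex scale A \<phi>) n f) =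
          cohomology_class (HH_complex scale (A 0)) n (restrict_cochain (A 0) n (f n)))"
    by (rule HHdg_to_HH[OF assms])
  show "\<exists>F. cohomology_linear (HCP_complex scale A n) 0 (HHP_complex scale A n) 0 F \<and>
       (\<forall>f \<in> cocycles (HCP_complex scale A n) 0.
          F (cohomology_class (HCP_complex scale A n) 0 f) =
          cohomology_class (HHP_complex scale A n) 0 (f 0))"
    unfolding HCP_complex_def HHP_complex_def
    by (intro cyclic_to_b_complex subspace_graded_cochains linear_op_b linear_op_B)
  show "\<exists>F. cohomology_linear (HC_complex scale (A 0)) n (HH_complex scale (A 0)) n F \<and>
       (\<forall>f \<in> cocycles (HC_complex scale (A 0)) n.
          F (cohomology_class (HC_complex scale (A 0)) n f) =
          cohomology_class (HH_complex scale (A 0)) n (f 0))"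
    unfolding HC_complex_def HH_complex_def
    by (intro cyclic_to_b_complex subspace_ungraded_cochains linear_op_b linear_op_B)
qed

end
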